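(* Let $X=(X_1,\ldots,X_n)$ be a random vector, and let $\mathcal{L}$ be a distributive lattice of subsets of $[n]=\{1,\ldots,n\}$ (under $\cup$ and $\cap$) consisting of all order ideals, including $\emptyset$ and $[n]$, of a partial order $\le$ on $[n]$. Suppose the marginals $p_J$, $J\in\mathcal{L}$, of the distribution of $X$ are positive, that there are functions $z_1,\ldots,z_n$ with $$p_J=\prod_{i\in J} z_i\qquad\text{for all } J\in\mathcal{L},$$ and that the marginals satisfy the Hibi relations $$p_I\,p_J=p_{I\cap J}\,p_{I\cup J}\qquad\text{for all } I,J\in\mathcal{L}.$$ Then: (i) The quantities $z_i$ are conditional probabilities: for every $i\in[n]$, $$z_i=p_{\{j:\,j\le i\}\,|\,\{j:\,j<i\}}.$$ (ii) The Hibi relations give all conditional independence statements associated with the lattice: for all $I,J\in\mathcal{L}$, the relation $p_Ip_J=p_{I\cap J}p_{I\cup J}$ expresses the conditional independence $$X_{I\setminus J}\perp\!\!\!\perp X_{J\setminus I}\mid X_{I\cap J},$$ and so this conditional independence holds for every pair $I,J\in\mathcal{L}$.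
   Context: The vector $X=(X_1,\ldots,X_n)$ takes values in a product space $\mathcal{X}_1\times\cdots\times\mathcal{X}_n$ and has a probability mass function (discrete case) or a density (continuous case) $p$ with respect to a product reference measure. For $I\subseteq[n]$, write $X_I=(X_i)_{i\in I}$ and $x_I=(x_i)_{i\in I}$. The $I$-margin $p_I=p_I(x_I)$ is the mass function or density of $X_I$, obtained from $p$ by summing or integrating over the variables indexed by $[n]\setminus I$; by convention $p_\emptyset=1$ and an empty product equals $1$. "Positive marginals" means that $p_J(x_J)$ is finite and $>0$ for all $J\in\mathcal{L}$ and all $x=(x_1,\ldots,x_n)$. All identities among the $p_J$ and the $z_i$ are identities of functions of $x$. For example, $p_J=\prod_{i\in J}z_i$ means $p_J(x_J)=\prod_{i\in J}z_i(x)$ for all $x$, and the Hibi relation means $p_I(x_I)p_J(x_J)=p_{I\cap J}(x_{I\cap J})p_{I\cup J}(x_{I\cup J})$ for all $x$. Order: a subset $I\subseteq[n]$ is an order ideal of $([n],\le)$ if $i\in I$ and $j\le i$ imply $j\in I$. Equivalently to giving $\le$, for each $i$ the set $\{j: j\le i\}$ is the smallest element of $\mathcal{L}$ containing $i$ (the join-irreducible element of $\mathcal{L}$ corresponding to $i$). Both $\{j:j\le i\}$ and $\{j:j<i\}$ belong to $\mathcal{L}$. Conditional margins: for $J'\subseteq J$ in $\mathcal{L}$, $p_{J|J'}=p_J/p_{J'}$, i.e. the conditional mass function or density of $X_{J\setminus J'}$ given $X_{J'}$. In particular $p_{\{j:j\le i\}|\{j:j<i\}}$ is the conditional mass function or density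 of $X_i$ given its ancestors $X_{\{j:j<i\}}$. The conditional independence statements associated with $\mathcal{L}$ are the statements $X_{I\setminus J}\perp\!\!\!\perp X_{J\setminus I}\mid X_{I\cap J}$ for $I,J\in\mathcal{L}$ (trivially true if $I\subseteq J$ or $J\subseteq I$; unconditional independence if $I\cap J=\emptyset$). *)

theory Defs
  imports "HOL-Probability.Probability"
begin

text \<open>
  The partial order on \<open>[n] = {1..n}\<close> is a relation \<open>r\<close>, with \<open>(j, i) \<in> r\<close> meaning \<open>j \<le> i\<close>.
  Hence \<open>under r i\<close> is \<open>{j. j \<le> i}\<close> and \<open>underS r i\<close> is \<open>{j. j < i}\<close>.
\<close>

definition order_ideals :: "nat \<Rightarrow> (nat \<times> nat) set \<Rightarrow> nat set set" where
  "order_ideals n r = {I. I \<subseteq> {1..n} \<and> (\<forall>i\<in>I. \<forall>j. (j, i) \<in> r \<longrightarrow> j \<in> I)}"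

text \<open>
  \<open>M i\<close> is the reference measure on the \<open>i\<close>-th factor, and \<open>p\<close> is a density with respect to
  \<open>Pi\<^sub>M {1..n} M\<close>; mass functions are the case of counting measures. The \<open>I\<close>-margin is regarded as a
  function of the full point \<open>x\<close> that only depends on the coordinates in \<open>I\<close>. For \<open>I = {}\<close> it is the
  total integral of \<open>p\<close>, which is 1 for a probability density. The value may be infinite here;
  \<open>margin\<close> is the real-valued version, meaningful where \<open>emargin\<close> is finite.
\<close>

definition emargin ::
  "nat \<Rightarrow> (nat \<Rightarrow> 'a measure) \<Rightarrow> ((nat \<Rightarrow> 'a) \<Rightarrow> ennreal) \<Rightarrow> nat set \<Rightarrow> (nat \<Rightarrow> 'a) \<Rightarrow> ennreal" where
  "emargin n M p I x = (\<integral>\<^sup>+ y. p (merge I ({1..n} - I) (x, y)) \<partial>Pi\<^sub>M ({1..n} - I) M)"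

definition margin ::
  "nat \<Rightarrow> (nat \<Rightarrow> 'a measure) \<Rightarrow> ((nat \<Rightarrow> 'a) \<Rightarrow> ennreal) \<Rightarrow> nat set \<Rightarrow> (nat \<Rightarrow> 'a) \<Rightarrow> real" where
  "margin n M p I x = enn2real (emargin n M p I x)"

definition cond_margin ::
  "nat \<Rightarrow> (nat \<Rightarrow> 'a measure) \<Rightarrow> ((nat \<Rightarrow> 'a) \<Rightarrow> ennreal) \<Rightarrow> nat set \<Rightarrow> nat set \<Rightarrow> (nat \<Rightarrow> 'a) \<Rightarrow> real" where
  "cond_margin n M p J J' x = margin n M p J x / margin n M p J' x"

definition subvector :: "(nat \<Rightarrow> 'o \<Rightarrow> 'a) \<Rightarrow> nat set \<Rightarrow> 'o \<Rightarrow> (nat \<Rightarrow> 'a)" where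
  "subvector X I \<omega> = (\<lambda>i\<in>I. X i \<omega>)"

definition cond_prob_given ::
  "'o measure \<Rightarrow> 'c measure \<Rightarrow> ('o \<Rightarrow> 'c) \<Rightarrow> 'o set \<Rightarrow> 'o \<Rightarrow> real" where
  "cond_prob_given P T Z E = real_cond_exp P (vimage_algebra (space P) Z T) (indicator E)"

text \<open>
  Conditional independence of \<open>A\<close> and \<open>B\<close> given \<open>Z\<close>, for random variables with values in arbitrary
  measurable spaces \<open>S\<close>, \<open>S'\<close> and \<open>T\<close> (argument order as in \<open>indep_var\<close>): given the sigma-algebra
  generated by \<open>Z\<close>, conditional probabilities of events of \<open>A\<close> and of \<open>B\<close> multiply almost surely.
\<close>

definition cond_indep_var ::
  "'o measure \<Rightarrow> 'a measure \<Rightarrow> ('o \<Rightarrow> 'a) \<Rightarrow> 'b measure \<Rightarrow> ('o \<Rightarrow> 'b) \<Rightarrow> 'c measure \<Rightarrow> ('o \<Rightarrow> 'c) \<Rightarrow> bool" where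
  "cond_indep_var P S A S' B T Z \<longleftrightarrow>
     A \<in> measurable P S \<and> B \<in> measurable P S' \<and> Z \<in> measurable P T \<and>
     (\<forall>a\<in>sets S. \<forall>b\<in>sets S'. AE \<omega> in P.
        cond_prob_given P T Z ((A -` a \<inter> space P) \<inter> (B -` b \<inter> space P)) \<omega> =
        cond_prob_given P T Z (A -` a \<inter> space P) \<omega> * cond_prob_given P T Z (B -` b \<inter> space P) \<omega>)"

definition cond_indep_subvectors ::
  "'o measure \<Rightarrow> (nat \<Rightarrow> 'a measure) \<Rightarrow> (nat \<Rightarrow> 'o \<Rightarrow> 'a) \<Rightarrow> nat set \<Rightarrow> nat set \<Rightarrow> nat set \<Rightarrow> bool" where
  "cond_indep_subvectors P M X I J K \<longleftrightarrow>
     cond_indep_var P (Pi\<^sub>M I M) (subvector X I) (Pi\<^sub>M J M) (subvector X J) (Pi\<^sub>M K M) (subvector X K)"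

definition hibi_relation_at ::
  "nat \<Rightarrow> (nat \<Rightarrow> 'a measure) \<Rightarrow> ((nat \<Rightarrow> 'a) \<Rightarrow> ennreal) \<Rightarrow> nat set \<Rightarrow> nat set \<Rightarrow> (nat \<Rightarrow> 'a) \<Rightarrow> bool" where
  "hibi_relation_at n M p I J x \<longleftrightarrow>
     margin n M p I x * margin n M p J x = margin n M p (I \<inter> J) x * margin n M p (I \<union> J) x"

end

theory Submission
  imports Defs
begin

text \<open>
  Split the coordinates into \<open>C = I \<inter> J\<close>, \<open>A = I - J\<close>, \<open>B = J - I\<close>, and let \<open>q (w, (u, v))\<close> be the
  joint density of \<open>(X\<^sub>C, (X\<^sub>A, X\<^sub>B))\<close>. The conditional probability of \<open>X\<^sub>A \<in> a\<close>
  given \<open>X\<^sub>C = w\<close> is the integral of the \<open>I\<close>-margin over \<open>a\<close>, divided by the \<open>C\<close>-margin, and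
  similarly for the other events. Hence conditional independence says that \<open>q\<close> and
  \<open>q\<^sub>I q\<^sub>J / q\<^sub>C\<close> have, for almost every \<open>w\<close>, the same integral over every rectangle
  \<open>a \<times> b\<close>. Rectangles form a generator closed under intersection, so this is the Hibi relation
  almost everywhere. For the conditional probabilities, divide the factorization of
  \<open>{j. j \<le> i}\<close> by that of \<open>{j. j < i}\<close>.
\<close>

section \<open>Conditional probabilities computed from a joint density\<close>

lemma cond_prob_given_density:
  fixes q :: "'c \<times> 'b \<Rightarrow> ennreal"
  assumes "prob_space P"
    and T: "sigma_finite_measure T" and R: "sigma_finite_measure R"
    and D: "distributed P (T \<Otimes>\<^sub>M R) (\<lambda>\<omega>. (W \<omega>, Y \<omega>)) q"
    and pos: "\<And>w. w \<in> space T \<Longrightarrow> 0 < (\<integral>\<^sup>+ y. q (w, y) \<partial>R) \<and> (\<integral>\<^sup>+ y. q (w, y) \<partial>R) < \<infinity>"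
    and e[measurable]: "e \<in> sets R"
  shows "AE \<omega> in P. cond_prob_given P T W (Y -` e \<inter> space P) \<omega> =
    enn2real ((\<integral>\<^sup>+ y. q (W \<omega>, y) * indicator e y \<partial>R) / (\<integral>\<^sup>+ y. q (W \<omega>, y) \<partial>R))"
proof -
  interpret prob_space P by fact
  interpret T: sigma_finite_measure T by fact
  interpret R: sigma_finite_measure R by fact
  define F where "F = vimage_algebra (space P) W T"
  have WY: "(\<lambda>\<omega>. (W \<omega>, Y \<omega>)) \<in> measurable P (T \<Otimes>\<^sub>M R)"
    and q[measurable]: "q \<in> borel_measurable (T \<Otimes>\<^sub>M R)"
    using D by (auto simp: distributed_def)
  have W[measurable]: "W \<in> measurable P T" and Y[measurable]: "Y \<in> measurable P R"
    using measurable_compose[OF WY measurable_fst] measurable_compose[OF WY measurable_snd] by simp_all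
  have Wsp: "W \<in> space P \<rightarrow> space T"
    using measurable_space[OF W] by auto
  \<comment> \<open>Every event of the generated sigma-algebra is a preimage under \<open>W\<close>;
    these are the only test sets needed below.\<close>
  have setsF: "sets F = {W -` c \<inter> space P | c. c \<in> sets T}"
    unfolding F_def by (rule sets_vimage_algebra2[OF Wsp])
  have "subalgebra P F"
    using measurable_sets[OF W] by (auto simp: subalgebra_def setsF) (simp_all add: F_def)
  interpret F: finite_measure_subalgebra P F
    by (rule finite_measure_subalgebra.intro) (unfold_locales, fact)
  have WF[measurable]: "W \<in> measurable F T"
    unfolding F_def by (rule measurable_vimage_algebra1[OF Wsp])
  let ?m = "\<lambda>w. \<integral>\<^sup>+ y. q (w, y) \<partial>R"
  define h where "h w = (\<integral>\<^sup>+ y. q (w, y) * indicator e y \<partial>R) / ?m w" for w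
  have h[measurable]: "h \<in> borel_measurable T" unfolding h_def by measurable
  \<comment> \<open>The bound by 1 serves twice: it gives integrability on a probability space, and
    it makes \<open>enn2real\<close> faithful on the values of \<open>h\<close>.\<close>
  have h_le_1: "h w \<le> 1" if "w \<in> space T" for w
  proof -
    have "(\<integral>\<^sup>+ y. q (w, y) * indicator e y \<partial>R) \<le> ?m w"
      by (intro nn_integral_mono) (auto split: split_indicator)
    then show ?thesis unfolding h_def using pos[OF that] by (intro divide_le_posI_ennreal) auto
  qed
  have enn_h: "ennreal (enn2real (h (W \<omega>))) = h (W \<omega>)" if "\<omega> \<in> space P" for \<omega>
    using h_le_1[OF measurable_space[OF W that]] by (intro ennreal_enn2real) (auto simp: less_top[symmetric] top_unique)
  let ?E = "Y -` e \<inter> space P"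
  have "AE \<omega> in P. real_cond_exp P F (indicator ?E) \<omega> = enn2real (h (W \<omega>))"
  proof (rule F.real_cond_exp_charact)
    show "integrable P (indicator ?E :: _ \<Rightarrow> real)" by (auto simp: emeasure_finite less_top[symmetric])
    show "integrable P (\<lambda>\<omega>. enn2real (h (W \<omega>)))"
    proof (rule integrable_const_bound[of _ 1])
      show "AE \<omega> in P. norm (enn2real (h (W \<omega>))) \<le> 1"
        using h_le_1[OF measurable_space[OF W]] by (intro AE_I2) (auto intro!: enn2real_leI)
    qed measurable
    show "(\<lambda>\<omega>. enn2real (h (W \<omega>))) \<in> borel_measurable F" by measurable
    \<comment> \<open>The test identity is first proved for nonnegative integrals: move to the
      product space, integrate over \<open>y\<close> for fixed \<open>w\<close>, use
      \<open>?m w * h w\<close>, and move back. Only at the end is it read off for real-valued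
      integrals.\<close>
    fix A assume "A \<in> sets F"
    then obtain c where A: "A = W -` c \<inter> space P" and c[measurable]: "c \<in> sets T"
      by (auto simp: setsF)
    have "(\<integral>\<^sup>+ \<omega>. indicator c (W \<omega>) * h (W \<omega>) \<partial>P)
        = (\<integral>\<^sup>+ t. q t * (indicator c (fst t) * h (fst t)) \<partial>(T \<Otimes>\<^sub>M R))"
      by (subst distributed_nn_integral[OF D]) simp_all
    also have "\<dots> = (\<integral>\<^sup>+ w. (\<integral>\<^sup>+ y. q (w, y) * (indicator c w * h w) \<partial>R) \<partial>T)"
      by (subst R.nn_integral_fst[symmetric]) simp_all
    also have "\<dots> = (\<integral>\<^sup>+ w. (\<integral>\<^sup>+ y. q (w, y) * (indicator c w * indicator e y) \<partial>R) \<partial>T)"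
    proof (rule nn_integral_cong)
      fix w assume w[measurable]: "w \<in> space T"
      have mh: "?m w * h w = (\<integral>\<^sup>+ y. q (w, y) * indicator e y \<partial>R)"
        using pos[OF w]
        by (auto simp: h_def ennreal_times_divide mult.commute[of "?m w"] intro!: mult_divide_eq_ennreal)
      have "(\<integral>\<^sup>+ y. q (w, y) * (indicator c w * h w) \<partial>R) = ?m w * (indicator c w * h w)"
        by (rule nn_integral_multc) measurable
      also have "\<dots> = indicator c w * (?m w * h w)" by (simp add: ac_simps)
      also have "\<dots> = indicator c w * (\<integral>\<^sup>+ y. q (w, y) * indicator e y \<partial>R)"
        by (simp only: mh)
      also have "\<dots> = (\<integral>\<^sup>+ y. q (w, y) * (indicator c w * indicator e y) \<partial>R)"
        by (subst nn_integral_cmult[symmetric]) (simp_all add: ac_simps)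
      finally show "(\<integral>\<^sup>+ y. q (w, y) * (indicator c w * h w) \<partial>R) =
        (\<integral>\<^sup>+ y. q (w, y) * (indicator c w * indicator e y) \<partial>R)" .
    qed
    also have "\<dots> = (\<integral>\<^sup>+ t. q t * (indicator c (fst t) * indicator e (snd t)) \<partial>(T \<Otimes>\<^sub>M R))"
      by (subst R.nn_integral_fst[symmetric]) simp_all
    also have "\<dots> = (\<integral>\<^sup>+ \<omega>. indicator c (W \<omega>) * indicator e (Y \<omega>) \<partial>P)"
      by (subst distributed_nn_integral[OF D]) simp_all
    finally have *: "(\<integral>\<^sup>+ \<omega>. indicator c (W \<omega>) * h (W \<omega>) \<partial>P) =
      (\<integral>\<^sup>+ \<omega>. indicator c (W \<omega>) * indicator e (Y \<omega>) \<partial>P)" .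
    have "(LINT \<omega>:A|P. enn2real (h (W \<omega>))) = enn2real (\<integral>\<^sup>+ \<omega>. indicator c (W \<omega>) * h (W \<omega>) \<partial>P)"
      unfolding set_lebesgue_integral_def A
      by (subst integral_eq_nn_integral)
        (auto intro!: arg_cong[where f=enn2real] nn_integral_cong simp: enn_h split: split_indicator)
    moreover have "(LINT \<omega>:A|P. indicator ?E \<omega>) =
        enn2real (\<integral>\<^sup>+ \<omega>. indicator c (W \<omega>) * indicator e (Y \<omega>) \<partial>P)"
      unfolding set_lebesgue_integral_def A
      by (subst integral_eq_nn_integral)
        (auto intro!: arg_cong[where f=enn2real] nn_integral_cong split: split_indicator)
    ultimately show "(LINT \<omega>:A|P. indicator ?E \<omega>) = (LINT \<omega>:A|P. enn2real (h (W \<omega>)))"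
      using * by simp
  qed
  then show ?thesis by (simp add: cond_prob_given_def F_def h_def)
qed

section \<open>Conditional independence as an equation between densities\<close>

lemma ennreal_eq_divide_iff:
  fixes a x m :: ennreal
  assumes "m \<noteq> 0" "m \<noteq> top"
  shows "a = x / m \<longleftrightarrow> x = m * a"
  using assms by (auto simp: ennreal_times_divide) (simp_all add: mult.commute[of m] mult_divide_eq_ennreal)

text \<open>In \<open>eq\<close> the exceptional null set may depend on \<open>a\<close> and
  \<open>b\<close>, so sections cannot be compared at a fixed \<open>w\<close>. Integrating over
  \<open>c\<close> in \<open>T\<close> removes this dependence: the two densities define measures
  that agree on all boxes \<open>c \<times> (a \<times> b)\<close>, hence equal measures, and a
  finite measure determines its density almost everywhere.\<close>

lemma density_AE_eq_rectangles:
  fixes f g :: "'c \<times> ('a \<times> 'b) \<Rightarrow> ennreal"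
  assumes S: "sigma_finite_measure S" and S': "sigma_finite_measure S'"
    and f[measurable]: "f \<in> borel_measurable (T \<Otimes>\<^sub>M (S \<Otimes>\<^sub>M S'))"
    and g[measurable]: "g \<in> borel_measurable (T \<Otimes>\<^sub>M (S \<Otimes>\<^sub>M S'))"
    and fin: "integral\<^sup>N (T \<Otimes>\<^sub>M (S \<Otimes>\<^sub>M S')) f \<noteq> \<infinity>"
    and eq: "\<And>a b. a \<in> sets S \<Longrightarrow> b \<in> sets S' \<Longrightarrow> AE w in T.
      (\<integral>\<^sup>+ y. f (w, y) * indicator (a \<times> b) y \<partial>(S \<Otimes>\<^sub>M S')) = (\<integral>\<^sup>+ y. g (w, y) * indicator (a \<times> b) y \<partial>(S \<Otimes>\<^sub>M S'))"
  shows "AE t in T \<Otimes>\<^sub>M (S \<Otimes>\<^sub>M S'). f t = g t"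
proof -
  interpret SS: pair_sigma_finite S S'
    using S S' by (simp add: pair_sigma_finite_def)
  let ?R = "S \<Otimes>\<^sub>M S'"
  let ?N = "T \<Otimes>\<^sub>M ?R"
  have R: "sigma_finite_measure ?R" ..
  let ?rect = "{a \<times> b | a b. a \<in> sets S \<and> b \<in> sets S'}"
  let ?E = "{c \<times> d | c d. c \<in> sets T \<and> d \<in> ?rect}"
  \<comment> \<open>The generator of the nested product is built on the inner rectangles instead of
    all measurable sets of \<open>?R\<close>; the covers required for this consist of the whole
    spaces alone.\<close>
  have "sets ?N = sets (sigma (space T \<times> space ?R) ?E)"
  proof (rule sets_pair_eq[where Ca="{space T}" and Cb="{space ?R}"])
    show "sets ?R = sigma_sets (space ?R) ?rect"
      by (simp add: sets_pair_measure space_pair_measure)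
    show "{space ?R} \<subseteq> ?rect" by (auto simp: space_pair_measure)
    show "?rect \<subseteq> Pow (space ?R)" by (auto simp: space_pair_measure dest: sets.sets_into_space)
    show "sets T = sigma_sets (space T) (sets T)" by (rule sets.sigma_sets_eq[symmetric])
  qed (auto dest: sets.sets_into_space)
  moreover have ER: "?E \<subseteq> Pow (space T \<times> space ?R)"
    by (auto simp: space_pair_measure dest: sets.sets_into_space)
  ultimately have gen: "sets ?N = sigma_sets (space T \<times> space ?R) ?E"
    by simp
  \<comment> \<open>A constant sequence suffices as exhaustion, because \<open>fin\<close> makes the
    mass of the whole space finite.\<close>
  have "density ?N f = density ?N g"
  proof (rule measure_eqI_generator_eq[where E="?E" and A="\<lambda>_. space ?N" and \<Omega>="space T \<times> space ?R"])
    have "Int_stable ?rect"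
      using Int_stable_pair_measure_generator[of S S'] by simp
    show "Int_stable ?E"
    proof (rule Int_stableI)
      fix x y assume "x \<in> ?E" "y \<in> ?E"
      then obtain c d c' d' where xy: "x = c \<times> d" "y = c' \<times> d'" "c \<in> sets T" "c' \<in> sets T"
        "d \<in> ?rect" "d' \<in> ?rect" by blast
      have "d \<inter> d' \<in> ?rect"
        using \<open>Int_stable ?rect\<close> xy(5,6) by (rule Int_stableD)
      moreover have "x \<inter> y = (c \<inter> c') \<times> (d \<inter> d')" using xy by auto
      ultimately show "x \<inter> y \<in> ?E" using xy(3,4) by blast
    qed
    show "?E \<subseteq> Pow (space T \<times> space ?R)" by (rule ER)
    show "range (\<lambda>_. space ?N) \<subseteq> ?E"
      by (auto simp: space_pair_measure)
    show "(\<Union>i::nat. space ?N) = space T \<times> space ?R" by (simp add: space_pair_measure)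
    show "emeasure (density ?N f) (space ?N) \<noteq> \<infinity>"
      using fin by (simp add: emeasure_density cong: nn_integral_cong)
    fix x assume "x \<in> ?E"
    then obtain c a b where x: "x = c \<times> (a \<times> b)" and [measurable]: "c \<in> sets T" "a \<in> sets S" "b \<in> sets S'"
      by blast
    have *: "emeasure (density ?N k) x = (\<integral>\<^sup>+ w. (\<integral>\<^sup>+ y. k (w, y) * indicator (a \<times> b) y \<partial>?R) * indicator c w \<partial>T)"
      if k[measurable]: "k \<in> borel_measurable ?N" for k
    proof -
      have "emeasure (density ?N k) x = (\<integral>\<^sup>+ t. k t * indicator (c \<times> (a \<times> b)) t \<partial>?N)"
        unfolding x by (rule emeasure_density) measurable
      also have "\<dots> = (\<integral>\<^sup>+ w. (\<integral>\<^sup>+ y. k (w, y) * indicator (c \<times> (a \<times> b)) (w, y) \<partial>?R) \<partial>T)"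
        by (rule sigma_finite_measure.nn_integral_fst[OF R, symmetric]) measurable
      also have "\<dots> = (\<integral>\<^sup>+ w. (\<integral>\<^sup>+ y. k (w, y) * indicator (a \<times> b) y * indicator c w \<partial>?R) \<partial>T)"
        by (intro nn_integral_cong) (auto split: split_indicator)
      also have "\<dots> = (\<integral>\<^sup>+ w. (\<integral>\<^sup>+ y. k (w, y) * indicator (a \<times> b) y \<partial>?R) * indicator c w \<partial>T)"
        by (intro nn_integral_cong nn_integral_multc) measurable
      finally show ?thesis .
    qed
    show "emeasure (density ?N f) x = emeasure (density ?N g) x"
      unfolding *[OF f] *[OF g] using eq[of a b] by (intro nn_integral_cong_AE) auto
  qed (simp_all add: gen)
  then show ?thesis
    using finite_density_unique[of f ?N g] fin by simp
qed

text \<open>Conditional independence fixes what the joint density must be, namely \<open>G\<close>,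
  the product of the two pair marginals divided by the marginal of \<open>W\<close>. Both directions
  compare \<open>q\<close> with \<open>G\<close> through section integrals over rectangles, and
  clearing the denominator gives the stated equation.\<close>

lemma cond_indep_var_iff_density:
  fixes q :: "'c \<times> ('a \<times> 'b) \<Rightarrow> ennreal"
  assumes "prob_space P"
    and S: "sigma_finite_measure S" and S': "sigma_finite_measure S'" and T: "sigma_finite_measure T"
    and D: "distributed P (T \<Otimes>\<^sub>M (S \<Otimes>\<^sub>M S')) (\<lambda>\<omega>. (W \<omega>, (U \<omega>, V \<omega>))) q"
    and pos: "\<And>w. w \<in> space T \<Longrightarrow>
      0 < (\<integral>\<^sup>+ y. q (w, y) \<partial>(S \<Otimes>\<^sub>M S')) \<and> (\<integral>\<^sup>+ y. q (w, y) \<partial>(S \<Otimes>\<^sub>M S')) < \<infinity>"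
  shows "cond_indep_var P S U S' V T W \<longleftrightarrow>
    (AE t in T \<Otimes>\<^sub>M (S \<Otimes>\<^sub>M S').
       (\<integral>\<^sup>+ v. q (fst t, (fst (snd t), v)) \<partial>S') * (\<integral>\<^sup>+ u. q (fst t, (u, snd (snd t))) \<partial>S) =
       (\<integral>\<^sup>+ y. q (fst t, y) \<partial>(S \<Otimes>\<^sub>M S')) * q t)"
proof -
  interpret prob_space P by fact
  interpret SS: pair_sigma_finite S S'
    using S S' by (simp add: pair_sigma_finite_def)
  let ?R = "S \<Otimes>\<^sub>M S'"
  have R: "sigma_finite_measure ?R" ..
  interpret TR: pair_sigma_finite T ?R
    using T R by (simp add: pair_sigma_finite_def)
  let ?N = "T \<Otimes>\<^sub>M ?R"
  have Y: "(\<lambda>\<omega>. (W \<omega>, (U \<omega>, V \<omega>))) \<in> measurable P ?N"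
    and q[measurable]: "q \<in> borel_measurable ?N"
    using D by (auto simp: distributed_def)
  have W[measurable]: "W \<in> measurable P T"
    using measurable_compose[OF Y measurable_fst] by simp
  have UV: "(\<lambda>\<omega>. (U \<omega>, V \<omega>)) \<in> measurable P ?R"
    using measurable_compose[OF Y measurable_snd] by simp
  have U[measurable]: "U \<in> measurable P S" and V[measurable]: "V \<in> measurable P S'"
    using measurable_compose[OF UV measurable_fst] measurable_compose[OF UV measurable_snd] by simp_all
  define m where "m w = (\<integral>\<^sup>+ y. q (w, y) \<partial>?R)" for w
  define qU where "qU w u = (\<integral>\<^sup>+ v. q (w, (u, v)) \<partial>S')" for w u
  define qV where "qV w v = (\<integral>\<^sup>+ u. q (w, (u, v)) \<partial>S)" for w v
  \<comment> \<open>\<open>Q w e\<close> and \<open>QG w e\<close> are the masses of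
    \<open>e\<close> under the sections of \<open>q\<close> and of \<open>G\<close> at
    \<open>w\<close>; conditional probabilities are the former divided by
    \<open>m w\<close>.\<close>
  define G where "G t = qU (fst t) (fst (snd t)) * qV (fst t) (snd (snd t)) / m (fst t)" for t
  define Q where "Q w e = (\<integral>\<^sup>+ y. q (w, y) * indicator e y \<partial>?R)" for w e
  define QG where "QG w e = (\<integral>\<^sup>+ y. G (w, y) * indicator e y \<partial>?R)" for w e
  have m[measurable]: "m \<in> borel_measurable T"
    unfolding m_def by measurable
  have qU[measurable]: "(\<lambda>t. qU (fst t) (snd t)) \<in> borel_measurable (T \<Otimes>\<^sub>M S)"
    unfolding qU_def by measurable
  have qV[measurable]: "(\<lambda>t. qV (fst t) (snd t)) \<in> borel_measurable (T \<Otimes>\<^sub>M S')"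
    unfolding qV_def by measurable
  have qU': "qU w \<in> borel_measurable S" and qV': "qV w \<in> borel_measurable S'" if "w \<in> space T" for w
    using measurable_compose[OF measurable_Pair1'[OF that] qU] measurable_compose[OF measurable_Pair1'[OF that] qV]
    by simp_all
  have G[measurable]: "G \<in> borel_measurable ?N"
  proof -
    have "(\<lambda>t. qU (fst t) (fst (snd t))) \<in> borel_measurable ?N"
      using measurable_compose[OF _ qU, of "\<lambda>t. (fst t, fst (snd t))" ?N] by simp
    moreover have "(\<lambda>t. qV (fst t) (snd (snd t))) \<in> borel_measurable ?N"
      using measurable_compose[OF _ qV, of "\<lambda>t. (fst t, snd (snd t))" ?N] by simp
    ultimately show ?thesis unfolding G_def by measurable
  qed
  have pos': "0 < m w" "m w < \<infinity>" if "w \<in> space T" for w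
    using pos[OF that] by (simp_all add: m_def)
  have Q_m: "Q w e \<le> m w" for w e
    unfolding Q_def m_def by (intro nn_integral_mono) (auto split: split_indicator)
  have cp: "AE \<omega> in P. cond_prob_given P T W ((\<lambda>\<omega>. (U \<omega>, V \<omega>)) -` e \<inter> space P) \<omega> = enn2real (Q (W \<omega>) e / m (W \<omega>))"
    if "e \<in> sets ?R" for e
    unfolding Q_def m_def
    by (rule cond_prob_given_density[OF \<open>prob_space P\<close> T R D pos that])
  \<comment> \<open>A rectangle with one full side integrates that variable out. For fixed
    \<open>w\<close> the function \<open>G\<close> is a product of a function of \<open>u\<close>
    and a function of \<open>v\<close>, so its integral over a rectangle splits into the two
    one-sided masses.\<close>
  have Qrect: "Q w (a \<times> space S') = (\<integral>\<^sup>+ u. qU w u * indicator a u \<partial>S)"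
    "Q w (space S \<times> b) = (\<integral>\<^sup>+ v. qV w v * indicator b v \<partial>S')"
    "QG w (a \<times> b) = Q w (a \<times> space S') * Q w (space S \<times> b) / m w"
    if [measurable]: "a \<in> sets S" "b \<in> sets S'" and w[measurable]: "w \<in> space T" for a b w
  proof -
    note qU'[OF w, measurable] qV'[OF w, measurable]
    have "Q w (a \<times> space S') = (\<integral>\<^sup>+ u. (\<integral>\<^sup>+ v. q (w, (u, v)) * indicator (a \<times> space S') (u, v) \<partial>S') \<partial>S)"
      unfolding Q_def by (rule SS.M2.nn_integral_fst[symmetric]) measurable
    also have "\<dots> = (\<integral>\<^sup>+ u. (\<integral>\<^sup>+ v. q (w, (u, v)) * indicator a u \<partial>S') \<partial>S)"
      by (intro nn_integral_cong) (auto split: split_indicator)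
    also have "\<dots> = (\<integral>\<^sup>+ u. qU w u * indicator a u \<partial>S)"
      unfolding qU_def by (intro nn_integral_cong nn_integral_multc) measurable
    finally show 1: "Q w (a \<times> space S') = (\<integral>\<^sup>+ u. qU w u * indicator a u \<partial>S)" .
    have "Q w (space S \<times> b) = (\<integral>\<^sup>+ v. (\<integral>\<^sup>+ u. q (w, (u, v)) * indicator (space S \<times> b) (u, v) \<partial>S) \<partial>S')"
      unfolding Q_def by (rule SS.nn_integral_snd[symmetric]) measurable
    also have "\<dots> = (\<integral>\<^sup>+ v. (\<integral>\<^sup>+ u. q (w, (u, v)) * indicator b v \<partial>S) \<partial>S')"
      by (intro nn_integral_cong) (auto split: split_indicator)
    also have "\<dots> = (\<integral>\<^sup>+ v. qV w v * indicator b v \<partial>S')"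
      unfolding qV_def by (intro nn_integral_cong nn_integral_multc) measurable
    finally show 2: "Q w (space S \<times> b) = (\<integral>\<^sup>+ v. qV w v * indicator b v \<partial>S')" .
    have "QG w (a \<times> b) = (\<integral>\<^sup>+ u. (\<integral>\<^sup>+ v. G (w, (u, v)) * indicator (a \<times> b) (u, v) \<partial>S') \<partial>S)"
      unfolding QG_def by (rule SS.M2.nn_integral_fst[symmetric]) measurable
    also have "\<dots> = (\<integral>\<^sup>+ u. (\<integral>\<^sup>+ v. (qV w v * indicator b v) * (qU w u * indicator a u * inverse (m w)) \<partial>S') \<partial>S)"
      by (intro nn_integral_cong) (auto simp: G_def divide_ennreal_def ac_simps split: split_indicator)
    also have "\<dots> = (\<integral>\<^sup>+ u. (\<integral>\<^sup>+ v. qV w v * indicator b v \<partial>S') * (qU w u * indicator a u * inverse (m w)) \<partial>S)"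
      by (intro nn_integral_cong nn_integral_multc) measurable
    also have "\<dots> = (\<integral>\<^sup>+ v. qV w v * indicator b v \<partial>S') * ((\<integral>\<^sup>+ u. qU w u * indicator a u \<partial>S) * inverse (m w))"
      by (subst nn_integral_cmult, measurable, subst nn_integral_multc, measurable)
    finally show "QG w (a \<times> b) = Q w (a \<times> space S') * Q w (space S \<times> b) / m w"
      unfolding 1 2 by (simp add: divide_ennreal_def ac_simps)
  qed
  have DW: "distributed P T W m"
    unfolding m_def by (rule distr_marginal1[OF T R D])
  have rect_iff: "(AE \<omega> in P.
        cond_prob_given P T W ((U -` a \<inter> space P) \<inter> (V -` b \<inter> space P)) \<omega> =
        cond_prob_given P T W (U -` a \<inter> space P) \<omega> * cond_prob_given P T W (V -` b \<inter> space P) \<omega>) \<longleftrightarrow>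
      (AE w in T. Q w (a \<times> b) = QG w (a \<times> b))"
    if [measurable]: "a \<in> sets S" "b \<in> sets S'" for a b
  proof -
    \<comment> \<open>Events of \<open>U\<close> alone and of \<open>V\<close> alone become events
      of the pair with a full side, so that \<open>cp\<close> covers all three conditional
      probabilities.\<close>
    have e: "(U -` a \<inter> space P) \<inter> (V -` b \<inter> space P) = (\<lambda>\<omega>. (U \<omega>, V \<omega>)) -` (a \<times> b) \<inter> space P"
      "U -` a \<inter> space P = (\<lambda>\<omega>. (U \<omega>, V \<omega>)) -` (a \<times> space S') \<inter> space P"
      "V -` b \<inter> space P = (\<lambda>\<omega>. (U \<omega>, V \<omega>)) -` (space S \<times> b) \<inter> space P"
      using measurable_space[OF U] measurable_space[OF V] by auto
    have *: "enn2real (Q w (a \<times> b) / m w) = enn2real (Q w (a \<times> space S') / m w) * enn2real (Q w (space S \<times> b) / m w)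
        \<longleftrightarrow> Q w (a \<times> b) = QG w (a \<times> b)" if w: "w \<in> space T" for w
    proof -
      have mz: "m w \<noteq> 0" "m w \<noteq> top" using pos'[OF w] by auto
      \<comment> \<open>No section mass exceeds \<open>m w\<close>, so the quotients and their
        products are finite and \<open>enn2real\<close> is injective on them.\<close>
      have fin: "Q w e / m w \<noteq> top" for e
        using Q_m[of w e] pos'[OF w] by (auto simp: ennreal_divide_eq_top_iff top_unique)
      have "enn2real (Q w (a \<times> b) / m w) = enn2real (Q w (a \<times> space S') / m w) * enn2real (Q w (space S \<times> b) / m w)
        \<longleftrightarrow> enn2real (Q w (a \<times> b) / m w) = enn2real ((Q w (a \<times> space S') / m w) * (Q w (space S \<times> b) / m w))"
        by (simp add: enn2real_mult)
      also have "\<dots> \<longleftrightarrow> Q w (a \<times> b) / m w = (Q w (a \<times> space S') / m w) * (Q w (space S \<times> b) / m w)"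
        using fin by (metis ennreal_enn2real_if ennreal_mult_eq_top_iff)
      also have "(Q w (a \<times> space S') / m w) * (Q w (space S \<times> b) / m w) = QG w (a \<times> b) / m w"
        using w by (simp add: Qrect(3) divide_ennreal_def ac_simps)
      also have "Q w (a \<times> b) / m w = QG w (a \<times> b) / m w \<longleftrightarrow> Q w (a \<times> b) = QG w (a \<times> b)"
        using mz by (metis ennreal_divide_times ennreal_divide_self mult.right_neutral top.not_eq_extremum)
      finally show ?thesis .
    qed
    have "(AE \<omega> in P.
        cond_prob_given P T W ((U -` a \<inter> space P) \<inter> (V -` b \<inter> space P)) \<omega> =
        cond_prob_given P T W (U -` a \<inter> space P) \<omega> * cond_prob_given P T W (V -` b \<inter> space P) \<omega>) \<longleftrightarrow>
      (AE \<omega> in P. Q (W \<omega>) (a \<times> b) = QG (W \<omega>) (a \<times> b))"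
    proof (rule eventually_cong)
      show "AE \<omega> in P. \<omega> \<in> space P \<and>
          cond_prob_given P T W ((U -` a \<inter> space P) \<inter> (V -` b \<inter> space P)) \<omega> = enn2real (Q (W \<omega>) (a \<times> b) / m (W \<omega>)) \<and>
          cond_prob_given P T W (U -` a \<inter> space P) \<omega> = enn2real (Q (W \<omega>) (a \<times> space S') / m (W \<omega>)) \<and>
          cond_prob_given P T W (V -` b \<inter> space P) \<omega> = enn2real (Q (W \<omega>) (space S \<times> b) / m (W \<omega>))"
      proof (intro AE_conjI AE_space)
        show "AE \<omega> in P. cond_prob_given P T W ((U -` a \<inter> space P) \<inter> (V -` b \<inter> space P)) \<omega> = enn2real (Q (W \<omega>) (a \<times> b) / m (W \<omega>))"
          unfolding e(1) by (rule cp) measurable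
        show "AE \<omega> in P. cond_prob_given P T W (U -` a \<inter> space P) \<omega> = enn2real (Q (W \<omega>) (a \<times> space S') / m (W \<omega>))"
          unfolding e(2) by (rule cp) measurable
        show "AE \<omega> in P. cond_prob_given P T W (V -` b \<inter> space P) \<omega> = enn2real (Q (W \<omega>) (space S \<times> b) / m (W \<omega>))"
          unfolding e(3) by (rule cp) measurable
      qed
      fix \<omega> assume "\<omega> \<in> space P \<and>
          cond_prob_given P T W ((U -` a \<inter> space P) \<inter> (V -` b \<inter> space P)) \<omega> = enn2real (Q (W \<omega>) (a \<times> b) / m (W \<omega>)) \<and>
          cond_prob_given P T W (U -` a \<inter> space P) \<omega> = enn2real (Q (W \<omega>) (a \<times> space S') / m (W \<omega>)) \<and>
          cond_prob_given P T W (V -` b \<inter> space P) \<omega> = enn2real (Q (W \<omega>) (space S \<times> b) / m (W \<omega>))"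
      then show "(cond_prob_given P T W ((U -` a \<inter> space P) \<inter> (V -` b \<inter> space P)) \<omega> =
        cond_prob_given P T W (U -` a \<inter> space P) \<omega> * cond_prob_given P T W (V -` b \<inter> space P) \<omega>) \<longleftrightarrow>
        Q (W \<omega>) (a \<times> b) = QG (W \<omega>) (a \<times> b)"
        using *[of "W \<omega>"] measurable_space[OF W] by simp
    qed
    \<comment> \<open>Statements almost sure under \<open>P\<close> transfer to \<open>T\<close>
      only where the density \<open>m\<close> of \<open>W\<close> is positive; here that is
      everywhere.\<close>
    also have "\<dots> \<longleftrightarrow> (AE w in T. 0 < m w \<longrightarrow> Q w (a \<times> b) = QG w (a \<times> b))"
    proof (rule distributed_AE2[OF DW])
      show "Measurable.pred T (\<lambda>w. Q w (a \<times> b) = QG w (a \<times> b))"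
        unfolding Q_def QG_def by measurable
    qed
    also have "\<dots> \<longleftrightarrow> (AE w in T. Q w (a \<times> b) = QG w (a \<times> b))"
      using pos' by (intro AE_cong) auto
    finally show ?thesis .
  qed
  have "cond_indep_var P S U S' V T W \<longleftrightarrow>
    (\<forall>a\<in>sets S. \<forall>b\<in>sets S'. AE w in T. Q w (a \<times> b) = QG w (a \<times> b))"
    by (simp add: cond_indep_var_def rect_iff)
  also have "\<dots> \<longleftrightarrow> (AE t in ?N. q t = G t)"
  proof
    \<comment> \<open>The density of a probability distribution has integral 1, which supplies the
      finiteness required for uniqueness.\<close>
    assume *: "\<forall>a\<in>sets S. \<forall>b\<in>sets S'. AE w in T. Q w (a \<times> b) = QG w (a \<times> b)"
    have "(\<integral>\<^sup>+ t. q t * 1 \<partial>?N) = (\<integral>\<^sup>+ \<omega>. 1 \<partial>P)"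
      by (rule distributed_nn_integral[OF D]) measurable
    then have "integral\<^sup>N ?N q \<noteq> \<infinity>" by (simp add: emeasure_space_1)
    then show "AE t in ?N. q t = G t"
      using * by (intro density_AE_eq_rectangles[OF S S' q G]) (auto simp: Q_def QG_def)
  next
    assume "AE t in ?N. q t = G t"
    then have "AE w in T. AE y in ?R. q (w, y) = G (w, y)"
      by (rule TR.AE_pair)
    then have "AE w in T. Q w e = QG w e" for e
    proof eventually_elim
      case (elim w)
      then show ?case
        unfolding Q_def QG_def by (intro nn_integral_cong_AE) auto
    qed
    then show "\<forall>a\<in>sets S. \<forall>b\<in>sets S'. AE w in T. Q w (a \<times> b) = QG w (a \<times> b)" by blast
  qed
  also have "\<dots> \<longleftrightarrow> (AE t in ?N. qU (fst t) (fst (snd t)) * qV (fst t) (snd (snd t)) = m (fst t) * q t)"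
  proof (intro AE_cong)
    fix t assume "t \<in> space ?N"
    then have "m (fst t) \<noteq> 0" "m (fst t) \<noteq> top"
      using pos'[of "fst t"] by (auto simp: space_pair_measure)
    then show "q t = G t \<longleftrightarrow> qU (fst t) (fst (snd t)) * qV (fst t) (snd (snd t)) = m (fst t) * q t"
      unfolding G_def by (rule ennreal_eq_divide_iff)
  qed
  finally show ?thesis by (simp add: qU_def qV_def m_def)
qed

section \<open>Margins on finite product spaces\<close>

text \<open>Lets a margin be evaluated at whichever is convenient: a full point, its restriction, or
  a merged point.\<close>

lemma emargin_cong:
  assumes "\<And>i. i \<in> I \<Longrightarrow> x i = y i"
  shows "emargin n M p I x = emargin n M p I y"
proof -
  have "merge I ({1..n} - I) (x, z) = merge I ({1..n} - I) (y, z)" for z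
    using assms by (auto simp: merge_def)
  then show ?thesis by (simp add: emargin_def)
qed

context
  fixes M :: "nat \<Rightarrow> 'a measure"
  assumes product: "product_sigma_finite M"
begin

interpretation product_sigma_finite M by (rule product)

lemma measurable_merge_section:
  assumes "p \<in> borel_measurable (Pi\<^sub>M (I \<union> J) M)" and "x \<in> space (Pi\<^sub>M I M)"
  shows "(\<lambda>y. p (merge I J (x, y))) \<in> borel_measurable (Pi\<^sub>M J M)"
  by (rule measurable_compose[OF measurable_compose[OF measurable_Pair1'[OF assms(2)] measurable_merge] assms(1)])

lemma borel_measurable_emargin:
  assumes p: "p \<in> borel_measurable (Pi\<^sub>M {1..n} M)" and I: "I \<subseteq> {1..n}"
  shows "emargin n M p I \<in> borel_measurable (Pi\<^sub>M I M)"
proof -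
  interpret D: sigma_finite_measure "Pi\<^sub>M ({1..n} - I) M" by (rule sigma_finite) simp
  have "I \<union> ({1..n} - I) = {1..n}" using I by auto
  then have "(\<lambda>t. p (merge I ({1..n} - I) t)) \<in> borel_measurable (Pi\<^sub>M I M \<Otimes>\<^sub>M Pi\<^sub>M ({1..n} - I) M)"
    using measurable_compose[OF measurable_merge, of p I "{1..n} - I" M borel] p by simp
  from D.borel_measurable_nn_integral_fst[OF this] show ?thesis
    by (simp add: emargin_def[abs_def])
qed

text \<open>Tower property of margins: Tonelli on the complement of \<open>K\<close>, split into
  \<open>H\<close> and the remaining coordinates, where both ways of nesting \<open>merge\<close>
  yield the same point.\<close>

lemma emargin_fold:
  assumes p: "p \<in> borel_measurable (Pi\<^sub>M {1..n} M)"
    and KH: "K \<inter> H = {}" "K \<union> H \<subseteq> {1..n}" and x: "x \<in> space (Pi\<^sub>M K M)"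
  shows "emargin n M p K x = (\<integral>\<^sup>+ h. emargin n M p (K \<union> H) (merge K H (x, h)) \<partial>Pi\<^sub>M H M)"
proof -
  let ?D = "{1..n} - (K \<union> H)"
  have un: "{1..n} - K = H \<union> ?D" "K \<union> ({1..n} - K) = {1..n}" and fin: "finite H"
    using KH by (auto intro: finite_subset)
  have "(\<lambda>y. p (merge K ({1..n} - K) (x, y))) \<in> borel_measurable (Pi\<^sub>M ({1..n} - K) M)"
    by (rule measurable_merge_section[OF _ x]) (simp only: un(2) p)
  then have m: "(\<lambda>y. p (merge K (H \<union> ?D) (x, y))) \<in> borel_measurable (Pi\<^sub>M (H \<union> ?D) M)"
    by (simp only: un(1))
  have "emargin n M p K x = (\<integral>\<^sup>+ y. p (merge K (H \<union> ?D) (x, y)) \<partial>Pi\<^sub>M (H \<union> ?D) M)"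
    unfolding emargin_def un(1) ..
  also have "\<dots> = (\<integral>\<^sup>+ h. (\<integral>\<^sup>+ d. p (merge K (H \<union> ?D) (x, merge H ?D (h, d))) \<partial>Pi\<^sub>M ?D M) \<partial>Pi\<^sub>M H M)"
    by (rule product_nn_integral_fold[OF _ fin _ m]) auto
  also have "(\<lambda>h d. p (merge K (H \<union> ?D) (x, merge H ?D (h, d)))) = (\<lambda>h d. p (merge (K \<union> H) ?D (merge K H (x, h), d)))"
    using KH(1) by (intro ext arg_cong[where f=p]) (auto simp: merge_def)
  finally show ?thesis by (simp add: emargin_def)
qed

text \<open>Tonelli with the coordinates outside \<open>K\<close> innermost: there the factor
  \<open>g\<close> is constant and only the margin is left. Here \<open>p\<close> is any measurable
  function, so the lemma applies to the constant 1 as well as to the density.\<close>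

lemma nn_integral_PiM_restrict:
  assumes p: "p \<in> borel_measurable (Pi\<^sub>M {1..n} M)" and K: "K \<subseteq> {1..n}"
    and g: "g \<in> borel_measurable (Pi\<^sub>M K M)"
  shows "(\<integral>\<^sup>+ x. p x * g (restrict x K) \<partial>Pi\<^sub>M {1..n} M) = (\<integral>\<^sup>+ k. emargin n M p K k * g k \<partial>Pi\<^sub>M K M)"
proof -
  let ?D = "{1..n} - K"
  have un: "K \<union> ?D = {1..n}" and fin: "finite K"
    using K by (auto intro: finite_subset)
  have m: "(\<lambda>x. p x * g (restrict x K)) \<in> borel_measurable (Pi\<^sub>M (K \<union> ?D) M)"
    unfolding un using p measurable_compose[OF measurable_restrict_subset[OF K] g] by measurable
  have "(\<integral>\<^sup>+ x. p x * g (restrict x K) \<partial>Pi\<^sub>M (K \<union> ?D) M) =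
    (\<integral>\<^sup>+ k. (\<integral>\<^sup>+ d. p (merge K ?D (k, d)) * g (restrict (merge K ?D (k, d)) K) \<partial>Pi\<^sub>M ?D M) \<partial>Pi\<^sub>M K M)"
    by (rule product_nn_integral_fold[OF _ fin _ m]) auto
  also have "\<dots> = (\<integral>\<^sup>+ k. emargin n M p K k * g k \<partial>Pi\<^sub>M K M)"
  proof (rule nn_integral_cong)
    fix k assume k: "k \<in> space (Pi\<^sub>M K M)"
    \<comment> \<open>Equality holds as functions on all of \<open>nat\<close>, since points of
      \<open>Pi\<^sub>M K M\<close> are extensional.\<close>
    then have "restrict (merge K ?D (k, d)) K = k" for d
      by (auto simp: space_PiM PiE_def extensional_def merge_def restrict_def fun_eq_iff)
    moreover have "(\<lambda>d. p (merge K ?D (k, d))) \<in> borel_measurable (Pi\<^sub>M ?D M)"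
      by (rule measurable_merge_section[OF _ k]) (simp only: un p)
    ultimately show "(\<integral>\<^sup>+ d. p (merge K ?D (k, d)) * g (restrict (merge K ?D (k, d)) K) \<partial>Pi\<^sub>M ?D M)
        = emargin n M p K k * g k"
      by (simp add: nn_integral_multc emargin_def)
  qed
  finally show ?thesis unfolding un .
qed

text \<open>Tonelli twice, first separating \<open>C\<close> and then \<open>A\<close> from
  \<open>B\<close>, followed by reassembling the iterated integrals over the nested pair space used
  in the density criterion.\<close>

lemma nn_integral_PiM_merge3:
  assumes fin: "finite A" "finite B" "finite C"
    and disj: "A \<inter> B = {}" "C \<inter> (A \<union> B) = {}"
    and f: "f \<in> borel_measurable (Pi\<^sub>M (C \<union> (A \<union> B)) M)"
  shows "integral\<^sup>N (Pi\<^sub>M (C \<union> (A \<union> B)) M) f =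
    (\<integral>\<^sup>+ t. f (merge C (A \<union> B) (fst t, merge A B (snd t))) \<partial>(Pi\<^sub>M C M \<Otimes>\<^sub>M (Pi\<^sub>M A M \<Otimes>\<^sub>M Pi\<^sub>M B M)))"
proof -
  interpret A: sigma_finite_measure "Pi\<^sub>M A M" by (rule product_sigma_finite.sigma_finite[OF product fin(1)])
  interpret B: sigma_finite_measure "Pi\<^sub>M B M" by (rule product_sigma_finite.sigma_finite[OF product fin(2)])
  interpret AB: pair_sigma_finite "Pi\<^sub>M A M" "Pi\<^sub>M B M" ..
  have m: "(\<lambda>t. f (merge C (A \<union> B) (fst t, merge A B (snd t)))) \<in>
      borel_measurable (Pi\<^sub>M C M \<Otimes>\<^sub>M (Pi\<^sub>M A M \<Otimes>\<^sub>M Pi\<^sub>M B M))"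
    using f by measurable
  have "integral\<^sup>N (Pi\<^sub>M (C \<union> (A \<union> B)) M) f =
      (\<integral>\<^sup>+ w. (\<integral>\<^sup>+ s. f (merge C (A \<union> B) (w, s)) \<partial>Pi\<^sub>M (A \<union> B) M) \<partial>Pi\<^sub>M C M)"
    using fin by (intro product_nn_integral_fold disj f) auto
  also have "\<dots> = (\<integral>\<^sup>+ w. (\<integral>\<^sup>+ y. f (merge C (A \<union> B) (w, merge A B y)) \<partial>(Pi\<^sub>M A M \<Otimes>\<^sub>M Pi\<^sub>M B M)) \<partial>Pi\<^sub>M C M)"
  proof (rule nn_integral_cong)
    fix w assume w: "w \<in> space (Pi\<^sub>M C M)"
    have s: "(\<lambda>s. f (merge C (A \<union> B) (w, s))) \<in> borel_measurable (Pi\<^sub>M (A \<union> B) M)"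
      by (rule measurable_merge_section[OF f w])
    have "(\<integral>\<^sup>+ s. f (merge C (A \<union> B) (w, s)) \<partial>Pi\<^sub>M (A \<union> B) M) =
        (\<integral>\<^sup>+ u. (\<integral>\<^sup>+ v. f (merge C (A \<union> B) (w, merge A B (u, v))) \<partial>Pi\<^sub>M B M) \<partial>Pi\<^sub>M A M)"
      by (rule product_nn_integral_fold[OF disj(1) fin(1,2) s])
    also have "\<dots> = (\<integral>\<^sup>+ y. f (merge C (A \<union> B) (w, merge A B y)) \<partial>(Pi\<^sub>M A M \<Otimes>\<^sub>M Pi\<^sub>M B M))"
      by (rule B.nn_integral_fst) (rule measurable_compose[OF measurable_merge s])
    finally show "(\<integral>\<^sup>+ s. f (merge C (A \<union> B) (w, s)) \<partial>Pi\<^sub>M (A \<union> B) M) =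
        (\<integral>\<^sup>+ y. f (merge C (A \<union> B) (w, merge A B y)) \<partial>(Pi\<^sub>M A M \<Otimes>\<^sub>M Pi\<^sub>M B M))" .
  qed
  also have "\<dots> = (\<integral>\<^sup>+ t. f (merge C (A \<union> B) (fst t, merge A B (snd t))) \<partial>(Pi\<^sub>M C M \<Otimes>\<^sub>M (Pi\<^sub>M A M \<Otimes>\<^sub>M Pi\<^sub>M B M)))"
    using AB.nn_integral_fst[OF m] by simp
  finally show ?thesis .
qed

section \<open>The Hibi relation and conditional independence of subvectors\<close>

text \<open>The triple of subvectors has the margin of \<open>I \<union> J\<close> as density, and
  the marginals of that density are the margins of \<open>I\<close>, \<open>J\<close> and
  \<open>I \<inter> J\<close>; the density criterion thus becomes the Hibi relation. What remains is
  to carry null sets between the full product and the product of the three blocks.\<close>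

lemma hibi_relation_iff_cond_indep:
  assumes "prob_space P"
    and density: "distributed P (Pi\<^sub>M {1..n} M) (subvector X {1..n}) p"
    and IJ: "I \<subseteq> {1..n}" "J \<subseteq> {1..n}"
    and pos: "\<And>K x. K \<in> {I, J, I \<inter> J, I \<union> J} \<Longrightarrow> x \<in> space (Pi\<^sub>M {1..n} M) \<Longrightarrow>
      0 < emargin n M p K x \<and> emargin n M p K x < \<infinity>"
  shows "(AE x in Pi\<^sub>M {1..n} M. hibi_relation_at n M p I J x) \<longleftrightarrow>
    cond_indep_subvectors P M X (I - J) (J - I) (I \<inter> J)"
proof -
  interpret prob_space P by fact
  let ?N = "Pi\<^sub>M {1..n} M"
  define A B C where "A = I - J" and "B = J - I" and "C = I \<inter> J"
  define K where "K = C \<union> (A \<union> B)"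
  have sets: "C \<union> A = I" "C \<union> B = J" "I \<union> B = K" "J \<union> A = K" "I \<union> J = K" "I \<inter> J = C" "K \<subseteq> {1..n}"
    and disj: "A \<inter> B = {}" "C \<inter> (A \<union> B) = {}" "C \<inter> A = {}" "C \<inter> B = {}" "I \<inter> B = {}" "J \<inter> A = {}"
    and fin: "finite A" "finite B" "finite C"
    using IJ by (auto simp: A_def B_def C_def K_def intro: finite_subset)
  have X: "subvector X {1..n} \<in> measurable P ?N" and p[measurable]: "p \<in> borel_measurable ?N"
    using density by (auto simp: distributed_def)
  let ?T = "Pi\<^sub>M C M" and ?S = "Pi\<^sub>M A M" and ?S' = "Pi\<^sub>M B M"
  let ?R = "?S \<Otimes>\<^sub>M ?S'"
  note sf = product_sigma_finite.sigma_finite[OF product fin(3)] product_sigma_finite.sigma_finite[OF product fin(1)] product_sigma_finite.sigma_finite[OF product fin(2)]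
  interpret B: sigma_finite_measure ?S' by (rule sf(3))
  define glue where "glue t = merge C (A \<union> B) (fst t, merge A B (snd t))" for t :: "(nat \<Rightarrow> 'a) \<times> (nat \<Rightarrow> 'a) \<times> (nat \<Rightarrow> 'a)"
  define split where "split x = (restrict x C, (restrict x A, restrict x B))" for x :: "nat \<Rightarrow> 'a"
  define q where "q t = emargin n M p K (glue t)" for t
  define Y where "Y \<omega> = (subvector X C \<omega>, (subvector X A \<omega>, subvector X B \<omega>))" for \<omega>
  have glue: "glue \<in> measurable (?T \<Otimes>\<^sub>M ?R) (Pi\<^sub>M K M)"
    unfolding glue_def K_def by measurable
  have split_K: "split \<in> measurable (Pi\<^sub>M K M) (?T \<Otimes>\<^sub>M ?R)"
    unfolding split_def K_def by (intro measurable_Pair measurable_restrict_subset) auto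
  \<comment> \<open>This composite is the identity, whereas \<open>glue\<close> after
    \<open>split\<close> recovers only the coordinates in \<open>K\<close>. That is enough, since
    the margins involved depend on no others.\<close>
  have split_glue: "split (glue t) = t" if "t \<in> space (?T \<Otimes>\<^sub>M ?R)" for t
    using that disj
    by (cases t) (auto simp: split_def glue_def space_pair_measure space_PiM PiE_def extensional_def merge_def restrict_def fun_eq_iff)
  have glue_split: "glue (split x) i = x i" if "i \<in> K" for x i
    using that by (auto simp: split_def glue_def K_def merge_def)
  have Y_split: "Y \<omega> = split (restrict (subvector X {1..n} \<omega>) K)" for \<omega>
    using sets(7) by (auto simp: Y_def split_def subvector_def K_def fun_eq_iff restrict_def)
  have split_restrict: "split (restrict x K) = split x" for x
    by (auto simp: split_def K_def fun_eq_iff restrict_def)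
  have split: "split \<in> measurable ?N (?T \<Otimes>\<^sub>M ?R)"
    using measurable_compose[OF measurable_restrict_subset[OF sets(7)] split_K] by (simp add: split_restrict)
  have Y: "Y \<in> measurable P (?T \<Otimes>\<^sub>M ?R)"
    using measurable_compose[OF X split] by (simp add: Y_split[abs_def] split_restrict)
  have q: "q \<in> borel_measurable (?T \<Otimes>\<^sub>M ?R)"
    unfolding q_def by (rule measurable_compose[OF glue borel_measurable_emargin[OF p sets(7)]])
  \<comment> \<open>Change of variables from full points to triples. The weight \<open>f\<close> is
    left general: \<open>p\<close> identifies the density of \<open>Y\<close>, and a constant weight
    handles null sets.\<close>
  have transfer: "(\<integral>\<^sup>+ x. f x * g (split x) \<partial>?N) =
      (\<integral>\<^sup>+ t. emargin n M f K (glue t) * g t \<partial>(?T \<Otimes>\<^sub>M ?R))"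
    if f: "f \<in> borel_measurable ?N" and g: "g \<in> borel_measurable (?T \<Otimes>\<^sub>M ?R)" for f g
  proof -
    have gs: "(\<lambda>k. g (split k)) \<in> borel_measurable (Pi\<^sub>M K M)"
      by (rule measurable_compose[OF split_K g])
    have "(\<integral>\<^sup>+ x. f x * g (split x) \<partial>?N) = (\<integral>\<^sup>+ k. emargin n M f K k * g (split k) \<partial>Pi\<^sub>M K M)"
      using nn_integral_PiM_restrict[OF f sets(7) gs] by (simp add: split_restrict)
    also have "\<dots> = (\<integral>\<^sup>+ t. emargin n M f K (glue t) * g (split (glue t)) \<partial>(?T \<Otimes>\<^sub>M ?R))"
      unfolding glue_def K_def
      using borel_measurable_emargin[OF f sets(7)] gs unfolding K_def
      by (intro nn_integral_PiM_merge3 fin disj) measurable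
    also have "\<dots> = (\<integral>\<^sup>+ t. emargin n M f K (glue t) * g t \<partial>(?T \<Otimes>\<^sub>M ?R))"
      by (intro nn_integral_cong) (simp add: split_glue)
    finally show ?thesis .
  qed
  have DY: "distributed P (?T \<Otimes>\<^sub>M ?R) Y q"
    unfolding distributed_def
  proof (intro conjI q Y measure_eqI)
    fix E assume "E \<in> sets (distr P (?T \<Otimes>\<^sub>M ?R) Y)"
    then have E[measurable]: "E \<in> sets (?T \<Otimes>\<^sub>M ?R)" by simp
    have "emeasure (distr P (?T \<Otimes>\<^sub>M ?R) Y) E = (\<integral>\<^sup>+ t. indicator E t \<partial>distr P (?T \<Otimes>\<^sub>M ?R) Y)"
      by simp
    also have "\<dots> = (\<integral>\<^sup>+ \<omega>. indicator E (split (subvector X {1..n} \<omega>)) \<partial>P)"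
      by (subst nn_integral_distr[OF Y]) (simp_all add: Y_split split_restrict)
    also have "\<dots> = (\<integral>\<^sup>+ x. p x * indicator E (split x) \<partial>?N)"
      by (rule distributed_nn_integral[OF density, symmetric]) (rule measurable_compose[OF split], measurable)
    also have "\<dots> = (\<integral>\<^sup>+ t. q t * indicator E t \<partial>(?T \<Otimes>\<^sub>M ?R))"
      unfolding q_def by (rule transfer) measurable
    also have "\<dots> = emeasure (density (?T \<Otimes>\<^sub>M ?R) q) E"
      by (rule emeasure_density[OF q E, symmetric])
    finally show "emeasure (distr P (?T \<Otimes>\<^sub>M ?R) Y) E = emeasure (density (?T \<Otimes>\<^sub>M ?R) q) E" .
  qed simp
  \<comment> \<open>Positivity is assumed at full points only. A value of the random vector,
    available because a probability space is nonempty, fills in the missing coordinates.\<close>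
  obtain \<omega>\<^sub>0 where "\<omega>\<^sub>0 \<in> space P" using not_empty by blast
  then have x0: "subvector X {1..n} \<omega>\<^sub>0 \<in> space ?N" by (rule measurable_space[OF X])
  have posK: "0 < emargin n M p H x \<and> emargin n M p H x < \<infinity>"
    if H: "H \<in> {I, J, C, K}" and x: "x \<in> space (Pi\<^sub>M H M)" for H x
  proof -
    let ?y = "merge H ({1..n} - H) (x, subvector X {1..n} \<omega>\<^sub>0)"
    have "H \<subseteq> {1..n}" using H IJ sets by auto
    then have "?y \<in> space ?N"
      using x x0 by (auto simp: space_PiM PiE_def Pi_iff merge_def extensional_def)
    moreover have "emargin n M p H ?y = emargin n M p H x"
      by (rule emargin_cong) (simp add: merge_def)
    ultimately show ?thesis using pos[of H ?y] H sets by auto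
  qed
  \<comment> \<open>The margins of \<open>I\<close> and \<open>J\<close> arise by integrating out
    \<open>B\<close> and \<open>A\<close> respectively; the margin of \<open>C\<close> takes two
    stages, \<open>B\<close> first and then \<open>A\<close>, through
    \<open>C \<union> A = I\<close>.\<close>
  have marg_T: "(\<integral>\<^sup>+ y. q (w, y) \<partial>?R) = emargin n M p C w"
    and marg_U: "u \<in> space ?S \<Longrightarrow> (\<integral>\<^sup>+ v. q (w, (u, v)) \<partial>?S') = emargin n M p I (merge C A (w, u))"
    and marg_V: "v \<in> space ?S' \<Longrightarrow> (\<integral>\<^sup>+ u. q (w, (u, v)) \<partial>?S) = emargin n M p J (merge C B (w, v))"
    if w: "w \<in> space ?T" for w u v
  proof -
    have U: "(\<integral>\<^sup>+ v. q (w, (u, v)) \<partial>?S') = emargin n M p I (merge C A (w, u))" if u: "u \<in> space ?S" for u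
    proof -
      have "merge C A (w, u) \<in> space (Pi\<^sub>M I M)"
        using w u by (auto simp: sets(1)[symmetric] space_PiM PiE_def Pi_iff merge_def extensional_def)
      then have "emargin n M p I (merge C A (w, u)) =
          (\<integral>\<^sup>+ v. emargin n M p K (merge I B (merge C A (w, u), v)) \<partial>?S')"
        using emargin_fold[OF p disj(5)] sets by simp
      also have "(\<lambda>v. merge I B (merge C A (w, u), v)) = (\<lambda>v. glue (w, (u, v)))"
        using disj sets(1) by (auto simp: glue_def merge_def fun_eq_iff)
      finally show ?thesis by (simp add: q_def)
    qed
    then show "u \<in> space ?S \<Longrightarrow> (\<integral>\<^sup>+ v. q (w, (u, v)) \<partial>?S') = emargin n M p I (merge C A (w, u))" .
    show "(\<integral>\<^sup>+ u. q (w, (u, v)) \<partial>?S) = emargin n M p J (merge C B (w, v))" if v: "v \<in> space ?S'"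
    proof -
      have "merge C B (w, v) \<in> space (Pi\<^sub>M J M)"
        using w v by (auto simp: sets(2)[symmetric] space_PiM PiE_def Pi_iff merge_def extensional_def)
      then have "emargin n M p J (merge C B (w, v)) =
          (\<integral>\<^sup>+ u. emargin n M p K (merge J A (merge C B (w, v), u)) \<partial>?S)"
        using emargin_fold[OF p disj(6)] sets by simp
      also have "(\<lambda>u. merge J A (merge C B (w, v), u)) = (\<lambda>u. glue (w, (u, v)))"
        using disj sets(2) by (auto simp: glue_def merge_def fun_eq_iff)
      finally show ?thesis by (simp add: q_def)
    qed
    have "(\<integral>\<^sup>+ y. q (w, y) \<partial>?R) = (\<integral>\<^sup>+ u. (\<integral>\<^sup>+ v. q (w, (u, v)) \<partial>?S') \<partial>?S)"
      using B.nn_integral_fst[OF measurable_compose[OF measurable_Pair1'[OF w] q]] by simp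
    also have "\<dots> = (\<integral>\<^sup>+ u. emargin n M p I (merge C A (w, u)) \<partial>?S)"
      by (rule nn_integral_cong) (rule U)
    also have "\<dots> = emargin n M p C w"
      using emargin_fold[OF p disj(3) _ w] IJ by (simp add: sets)
    finally show "(\<integral>\<^sup>+ y. q (w, y) \<partial>?R) = emargin n M p C w" .
  qed
  define H where "H t \<longleftrightarrow> emargin n M p I (glue t) * emargin n M p J (glue t) =
      emargin n M p C (glue t) * emargin n M p K (glue t)" for t
  have H_pred: "Measurable.pred (?T \<Otimes>\<^sub>M ?R) H"
  proof -
    \<comment> \<open>A margin is known to be measurable only on its own coordinate space, so the
      glued point is restricted first; \<open>emargin_cong\<close> then drops the
      restriction.\<close>
    have [measurable]: "(\<lambda>t. emargin n M p L (glue t)) \<in> borel_measurable (?T \<Otimes>\<^sub>M ?R)"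
      if L: "L \<subseteq> K" for L
    proof -
      have "(\<lambda>t. emargin n M p L (restrict (glue t) L)) \<in> borel_measurable (?T \<Otimes>\<^sub>M ?R)"
        using measurable_compose[OF glue measurable_compose[OF measurable_restrict_subset[OF L] borel_measurable_emargin[OF p]]]
          L sets(7) by auto
      moreover have "emargin n M p L (restrict (glue t) L) = emargin n M p L (glue t)" for t
        by (rule emargin_cong) simp
      ultimately show ?thesis by simp
    qed
    have "I \<subseteq> K" "J \<subseteq> K" "C \<subseteq> K" using sets by auto
    then show ?thesis unfolding H_def by measurable
  qed
  have hibi_iff: "hibi_relation_at n M p I J x \<longleftrightarrow> H (split x)" if x: "x \<in> space ?N" for x
  proof -
    have "emargin n M p L (glue (split x)) = emargin n M p L x" if "L \<subseteq> K" for L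
      using that by (intro emargin_cong glue_split) auto
    \<comment> \<open>Finiteness makes the passage between the real-valued relation and its extended
      form \<open>H\<close> an equivalence.\<close>
    moreover have "emargin n M p L x \<noteq> \<top>" if "L \<in> {I, J, C, K}" for L
      using pos[of L x] x that sets by auto
    then have ne: "emargin n M p I x * emargin n M p J x \<noteq> \<top>" "emargin n M p C x * emargin n M p K x \<noteq> \<top>"
      by (auto simp: ennreal_mult_eq_top_iff)
    moreover have "I \<subseteq> K" "J \<subseteq> K" "C \<subseteq> K" using sets by auto
    ultimately have "H (split x) \<longleftrightarrow> emargin n M p I x * emargin n M p J x = emargin n M p C x * emargin n M p K x"
      by (simp add: H_def)
    also have "\<dots> \<longleftrightarrow> enn2real (emargin n M p I x * emargin n M p J x) = enn2real (emargin n M p C x * emargin n M p K x)"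
      using ne by (metis ennreal_enn2real_if)
    finally show ?thesis
      by (simp add: hibi_relation_at_def margin_def enn2real_mult sets)
  qed
  have q_pos: "0 < q t" if "t \<in> space (?T \<Otimes>\<^sub>M ?R)" for t
    using posK[of K "glue t"] measurable_space[OF glue that] by (simp add: q_def)
  have "(AE x in ?N. hibi_relation_at n M p I J x) \<longleftrightarrow> (AE x in ?N. H (split x))"
    using hibi_iff by (intro AE_cong) auto
  also have "\<dots> \<longleftrightarrow> (AE t in ?T \<Otimes>\<^sub>M ?R. H t)"
  proof
    assume *: "AE x in ?N. H (split x)"
    \<comment> \<open>This direction goes through \<open>P\<close>: an almost everywhere statement
      on the full product holds almost surely for the vector, hence almost surely for
      \<open>Y\<close>. Since the density \<open>q\<close> is positive everywhere, it then holds
      almost everywhere for the reference measure on triples.\<close>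
    have "Measurable.pred ?N (\<lambda>x. H (split x))"
      by (rule measurable_compose[OF split H_pred])
    with * have "AE \<omega> in P. H (split (subvector X {1..n} \<omega>))"
      by (subst distributed_AE2[OF density]) auto
    then have "AE \<omega> in P. H (Y \<omega>)" by (simp add: Y_split split_restrict)
    then have "AE t in ?T \<Otimes>\<^sub>M ?R. 0 < q t \<longrightarrow> H t"
      using distributed_AE2[OF DY H_pred] by simp
    then show "AE t in ?T \<Otimes>\<^sub>M ?R. H t"
      using AE_space by eventually_elim (auto intro: q_pos)
  next
    assume *: "AE t in ?T \<Otimes>\<^sub>M ?R. H t"
    \<comment> \<open>\<open>p\<close> may vanish, so null sets are carried over by \<open>transfer\<close> with the constant weight 1\<close>
    let ?Z = "{t \<in> space (?T \<Otimes>\<^sub>M ?R). \<not> H t}"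
    have Z[measurable]: "?Z \<in> sets (?T \<Otimes>\<^sub>M ?R)" using H_pred by measurable
    have "(\<integral>\<^sup>+ x. 1 * indicator ?Z (split x) \<partial>?N) =
        (\<integral>\<^sup>+ t. emargin n M (\<lambda>_. 1) K (glue t) * indicator ?Z t \<partial>(?T \<Otimes>\<^sub>M ?R))"
      by (rule transfer) measurable
    also have "\<dots> = (\<integral>\<^sup>+ t. 0 \<partial>(?T \<Otimes>\<^sub>M ?R))"
    proof (rule nn_integral_cong_AE)
      show "AE t in ?T \<Otimes>\<^sub>M ?R. emargin n M (\<lambda>_. 1) K (glue t) * indicator ?Z t = 0"
        using * by eventually_elim (simp add: indicator_def)
    qed
    finally have "(\<integral>\<^sup>+ x. indicator ?Z (split x) \<partial>?N) = 0" by simp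
    then have "AE x in ?N. (indicator ?Z (split x) :: ennreal) = 0"
      by (subst (asm) nn_integral_0_iff_AE) (rule measurable_compose[OF split], measurable)
    then show "AE x in ?N. H (split x)"
      using AE_space by eventually_elim (use measurable_space[OF split] in \<open>auto split: split_indicator_asm\<close>)
  qed
  also have "\<dots> \<longleftrightarrow> (AE t in ?T \<Otimes>\<^sub>M ?R.
       (\<integral>\<^sup>+ v. q (fst t, (fst (snd t), v)) \<partial>?S') * (\<integral>\<^sup>+ u. q (fst t, (u, snd (snd t))) \<partial>?S) =
       (\<integral>\<^sup>+ y. q (fst t, y) \<partial>?R) * q t)"
  proof (rule AE_cong)
    fix t assume "t \<in> space (?T \<Otimes>\<^sub>M ?R)"
    then obtain w u v where t: "t = (w, (u, v))" and s: "w \<in> space ?T" "u \<in> space ?S" "v \<in> space ?S'"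
      by (auto simp: space_pair_measure)
    \<comment> \<open>The marginals of \<open>q\<close> were found at partial points; all are now
      moved to the common point \<open>glue t\<close>.\<close>
    have "emargin n M p I (merge C A (w, u)) = emargin n M p I (glue t)"
      "emargin n M p J (merge C B (w, v)) = emargin n M p J (glue t)"
      "emargin n M p C w = emargin n M p C (glue t)"
      using disj by (auto intro!: emargin_cong simp: t glue_def merge_def sets(1,2)[symmetric])
    then show "H t \<longleftrightarrow> (\<integral>\<^sup>+ v. q (fst t, (fst (snd t), v)) \<partial>?S') * (\<integral>\<^sup>+ u. q (fst t, (u, snd (snd t))) \<partial>?S) =
       (\<integral>\<^sup>+ y. q (fst t, y) \<partial>?R) * q t"
      using s by (simp add: H_def t marg_T marg_U marg_V) (simp add: q_def t)
  qed
  also have "\<dots> \<longleftrightarrow> cond_indep_var P ?S (subvector X A) ?S' (subvector X B) ?T (subvector X C)"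
    using DY posK[of C]
    by (intro cond_indep_var_iff_density[OF \<open>prob_space P\<close> sf(2,3,1), symmetric])
      (simp_all add: Y_def[abs_def] marg_T)
  finally show ?thesis
    by (simp add: cond_indep_subvectors_def A_def B_def C_def)
qed

end

section \<open>Conclusions for the lattice of order ideals\<close>

text \<open>The first conjunct renders "expresses" as an equivalence, with the relation taken almost
  everywhere because conditional independence does not see null sets. The second conjunct draws the
  two conclusions from the factorization and the pointwise relations.\<close>

theorem theorem3p3:
  fixes n :: nat
    and r :: "(nat \<times> nat) set"
    and L :: "nat set set"
    and P :: "'o measure"
    and M :: "nat \<Rightarrow> 'a measure"
    and X :: "nat \<Rightarrow> 'o \<Rightarrow> 'a"
    and p :: "(nat \<Rightarrow> 'a) \<Rightarrow> ennreal"
    and z :: "nat \<Rightarrow> (nat \<Rightarrow> 'a) \<Rightarrow> real"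
  assumes order: "partial_order_on {1..n} r"
    and lattice: "L = order_ideals n r"
    and prob: "prob_space P"
    and reference: "\<forall>i\<in>{1..n}. sigma_finite_measure (M i)"
    and density: "distributed P (Pi\<^sub>M {1..n} M) (subvector X {1..n}) p"
    and positive: "\<forall>J\<in>L. \<forall>x\<in>space (Pi\<^sub>M {1..n} M). 0 < emargin n M p J x \<and> emargin n M p J x < \<infinity>"
  shows
    "(\<forall>I\<in>L. \<forall>J\<in>L.
        (AE x in Pi\<^sub>M {1..n} M. hibi_relation_at n M p I J x) \<longleftrightarrow>
        cond_indep_subvectors P M X (I - J) (J - I) (I \<inter> J)) \<and>
     ((\<forall>J\<in>L. \<forall>x\<in>space (Pi\<^sub>M {1..n} M). margin n M p J x = (\<Prod>i\<in>J. z i x)) \<longrightarrow>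
      (\<forall>I\<in>L. \<forall>J\<in>L. \<forall>x\<in>space (Pi\<^sub>M {1..n} M). hibi_relation_at n M p I J x) \<longrightarrow>
        (\<forall>i\<in>{1..n}. \<forall>x\<in>space (Pi\<^sub>M {1..n} M).
           z i x = cond_margin n M p (under r i) (underS r i) x) \<and>
        (\<forall>I\<in>L. \<forall>J\<in>L. cond_indep_subvectors P M X (I - J) (J - I) (I \<inter> J)))"
proof -
  \<comment> \<open>the locale \<open>product_sigma_finite\<close> wants sigma-finite factors at every index, not only in \<open>{1..n}\<close>\<close>
  define M' where "M' i = (if i \<in> {1..n} then M i else count_space {undefined})" for i
  have "sigma_finite_measure (M' i)" for i
    using reference by (auto simp: M'_def intro: sigma_finite_measure_count_space_finite)
  then have product: "product_sigma_finite M'"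
    by (rule product_sigma_finite.intro)
  have PiM_M': "Pi\<^sub>M K M = Pi\<^sub>M K M'" if "K \<subseteq> {1..n}" for K
    using that by (intro PiM_cong) (auto simp: M'_def)
  have emargin_M': "emargin n M p K = emargin n M' p K" for K
    using PiM_M'[of "{1..n} - K"] by (simp add: emargin_def[abs_def])
  have ideals: "K \<subseteq> {1..n}" if "K \<in> L" for K
    using that by (auto simp: lattice order_ideals_def)
  have closed: "I \<inter> J \<in> L" "I \<union> J \<in> L" if "I \<in> L" "J \<in> L" for I J
    using that by (auto simp: lattice order_ideals_def)
  have iff: "(AE x in Pi\<^sub>M {1..n} M. hibi_relation_at n M p I J x) \<longleftrightarrow>
      cond_indep_subvectors P M X (I - J) (J - I) (I \<inter> J)" if IJ: "I \<in> L" "J \<in> L" for I J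
  proof -
    have sub: "I \<subseteq> {1..n}" "J \<subseteq> {1..n}" using IJ ideals by auto
    have "(AE x in Pi\<^sub>M {1..n} M'. hibi_relation_at n M' p I J x) \<longleftrightarrow>
        cond_indep_subvectors P M' X (I - J) (J - I) (I \<inter> J)"
    proof (rule hibi_relation_iff_cond_indep[OF product prob _ sub])
      show "distributed P (Pi\<^sub>M {1..n} M') (subvector X {1..n}) p"
        using density by (simp only: PiM_M'[OF subset_refl])
      fix K x assume "K \<in> {I, J, I \<inter> J, I \<union> J}" "x \<in> space (Pi\<^sub>M {1..n} M')"
      then show "0 < emargin n M' p K x \<and> emargin n M' p K x < \<infinity>"
        using positive IJ closed[OF IJ] unfolding PiM_M'[OF subset_refl] emargin_M' by auto
    qed
    moreover have "hibi_relation_at n M p I J = hibi_relation_at n M' p I J"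
      by (simp add: hibi_relation_at_def[abs_def] margin_def emargin_M')
    moreover have "Pi\<^sub>M (I - J) M = Pi\<^sub>M (I - J) M'" "Pi\<^sub>M (J - I) M = Pi\<^sub>M (J - I) M'"
      "Pi\<^sub>M (I \<inter> J) M = Pi\<^sub>M (I \<inter> J) M'"
      using sub by (auto intro!: PiM_M')
    ultimately show ?thesis
      by (simp only: cond_indep_subvectors_def PiM_M'[OF subset_refl])
  qed
  have cond: "z i x = cond_margin n M p (under r i) (underS r i) x"
    if prod: "\<forall>J\<in>L. \<forall>x\<in>space (Pi\<^sub>M {1..n} M). margin n M p J x = (\<Prod>i\<in>J. z i x)"
      and i: "i \<in> {1..n}" and x: "x \<in> space (Pi\<^sub>M {1..n} M)" for i x
  proof -
    have r: "r \<subseteq> {1..n} \<times> {1..n}" "refl_on {1..n} r" "trans r" "antisym r"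
      using order by (auto simp: partial_order_on_def preorder_on_def)
    have under: "under r i = insert i (underS r i)" "i \<notin> underS r i"
      using r(2) i by (auto simp: under_def underS_def refl_on_def)
    \<comment> \<open>Transitivity closes both sets downwards. The strict one also uses
      antisymmetry: \<open>k \<le> j < i\<close> with \<open>k = i\<close> would force
      \<open>j = i\<close>.\<close>
    have "under r i \<in> L"
      using r(1) transD[OF r(3)] by (auto simp: lattice order_ideals_def under_def)
    moreover have S: "underS r i \<in> L"
      using r(1) transD[OF r(3)] antisymD[OF r(4)]
      by (auto simp: lattice order_ideals_def underS_def)
    ultimately have "margin n M p (under r i) x = z i x * margin n M p (underS r i) x"
      using prod x under ideals[OF S] by (simp add: finite_subset)
    moreover have "0 < margin n M p (underS r i) x"
      using positive S x by (auto simp: margin_def enn2real_positive_iff)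
    ultimately show ?thesis by (simp add: cond_margin_def)
  qed
  have ci: "cond_indep_subvectors P M X (I - J) (J - I) (I \<inter> J)"
    if "\<forall>I\<in>L. \<forall>J\<in>L. \<forall>x\<in>space (Pi\<^sub>M {1..n} M). hibi_relation_at n M p I J x"
      and "I \<in> L" "J \<in> L" for I J
    unfolding iff[OF that(2,3), symmetric] using that by (intro AE_I2) blast
  show ?thesis using iff cond ci by blast
qed

end
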